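(* Let $G$ and $H$ be two finite groups, and let $F\colon G\to H$ be a perfect nonlinear function. Then for every $\beta\in H$ the following inequality holds: $$\frac{|G|}{|H|}-\sqrt{|G|}+\frac{\sqrt{|G|}}{|H|}\le |F^{-1}(\beta)|\le \frac{|G|}{|H|}+\sqrt{|G|}-\frac{\sqrt{|G|}}{|H|}.$$ 1. If $|F^{-1}(\alpha)|=\frac{|G|}{|H|}-\sqrt{|G|}+\frac{\sqrt{|G|}}{|H|}$, then $|F^{-1}(\beta)|=\frac{|G|}{|H|}+\frac{\sqrt{|G|}}{|H|}$ for each $\beta\neq\alpha$. 2. If $|F^{-1}(\alpha)|=\frac{|G|}{|H|}+\sqrt{|G|}-\frac{\sqrt{|G|}}{|H|}$, then $|F^{-1}(\beta)|=\frac{|G|}{|H|}-\frac{\sqrt{|G|}}{|H|}$ for each $\beta\neq\alpha$. If equality takes place, then $|H|$ divides $\sqrt{|G|}$, and consequently $|G|$ is a square.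
   Context: Groups are written additively. A function $F\colon G\to H$ between finite groups is perfect nonlinear if $|\{x\in G: F(x+a)-F(x)=b\}|=|G|/|H|$ for all $a\in G\setminus\{0\}$ and all $b\in H$. $F^{-1}(\beta)$ denotes the preimage set of $\beta\in H$. "Equality takes place" means that one of the two bounds is attained by some element of $H$.
   Formalization: The last sentence (if equality takes place, |H| divides √|G| and |G| is a square) is proved only for nontrivial G and H; it fails for |H|=1, |G|=2 and for |G|=1, |H|>1. The inequality and items 1 and 2 are unrestricted. *)

theory Defs
  imports Complex_Main "HOL-Algebra.Algebra"
begin

text \<open>
  The groups need not be commutative. With HOL-Algebra's multiplicative records, the additive
  expression \<open>F (x + a) - F x\<close> reads \<open>F (x \<otimes> a) \<otimes> inv (F x)\<close>. The quotient of the
  orders is taken in the reals, so the condition can only hold (for nontrivial \<open>G\<close>) if the order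
  of \<open>H\<close> divides that of \<open>G\<close>.
\<close>

definition perfect_nonlinear ::
    "('a, 'm) monoid_scheme \<Rightarrow> ('b, 'n) monoid_scheme \<Rightarrow> ('a \<Rightarrow> 'b) \<Rightarrow> bool" where
  "perfect_nonlinear G H F \<longleftrightarrow>
     (\<forall>a \<in> carrier G - {\<one>\<^bsub>G\<^esub>}. \<forall>b \<in> carrier H.
        real (card {x \<in> carrier G. F (x \<otimes>\<^bsub>G\<^esub> a) \<otimes>\<^bsub>H\<^esub> inv\<^bsub>H\<^esub> (F x) = b})
          = real (order G) / real (order H))"

definition preimage_set :: "('a, 'm) monoid_scheme \<Rightarrow> ('a \<Rightarrow> 'b) \<Rightarrow> 'b \<Rightarrow> 'a set" where
  "preimage_set G F b = {x \<in> carrier G. F x = b}"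

definition lower_bound :: "('a, 'm) monoid_scheme \<Rightarrow> ('b, 'n) monoid_scheme \<Rightarrow> real" where
  "lower_bound G H =
     real (order G) / real (order H) - sqrt (real (order G))
       + sqrt (real (order G)) / real (order H)"

definition upper_bound :: "('a, 'm) monoid_scheme \<Rightarrow> ('b, 'n) monoid_scheme \<Rightarrow> real" where
  "upper_bound G H =
     real (order G) / real (order H) + sqrt (real (order G))
       - sqrt (real (order G)) / real (order H)"

end

theory Submission
  imports Defs
begin

text \<open>
  Counting the pairs \<open>(x, y)\<close> with \<open>F x = F y\<close> by the quotient \<open>a = x\<inverse> y\<close> determines the sum of the
  squares of the fibre sizes. The deviations of the fibre sizes from their mean \<open>|G| / |H|\<close>
  therefore have sum \<open>0\<close> and a known sum of squares, and the Cauchy--Schwarz inequality over the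
  fibres other than one chosen fibre bounds the deviation of that one; in the equality case the
  other deviations are all equal. Then \<open>\<surd>|G|\<close> is a difference of two fibre sizes, and the size
  \<open>|G| / |H| \<plusminus> \<surd>|G| / |H|\<close> is an integer, as is \<open>|G| / |H|\<close>.
\<close>

lemma sum_squares_shifted_deviation:
  fixes d :: "'a \<Rightarrow> real"
  assumes "finite S" "a \<in> S" "sum d S = 0"
  defines "m \<equiv> real (card S)"
  shows "(\<Sum>b\<in>S - {a}. ((m - 1) * d b + d a)\<^sup>2)
           = (m - 1) * ((m - 1) * (\<Sum>b\<in>S. (d b)\<^sup>2) - m * (d a)\<^sup>2)"
proof -
  have sum_d: "(\<Sum>b\<in>S - {a}. d b) = - d a"
    using assms by (simp add: sum_diff1)
  have sum_sq: "(\<Sum>b\<in>S - {a}. (d b)\<^sup>2) = (\<Sum>b\<in>S. (d b)\<^sup>2) - (d a)\<^sup>2"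
    using assms by (simp add: sum_diff1)
  have "card S \<ge> 1"
    using assms by (metis One_nat_def Suc_leI card_gt_0_iff empty_iff)
  then have card: "real (card (S - {a})) = m - 1"
    using assms by (simp add: of_nat_diff)
  have "(\<Sum>b\<in>S - {a}. ((m - 1) * d b + d a)\<^sup>2)
      = (\<Sum>b\<in>S - {a}. (m - 1)\<^sup>2 * (d b)\<^sup>2 + 2 * (m - 1) * d a * d b + (d a)\<^sup>2)"
    by (intro sum.cong) (auto simp: power2_eq_square algebra_simps)
  also have "\<dots> = (m - 1)\<^sup>2 * (\<Sum>b\<in>S - {a}. (d b)\<^sup>2)
      + 2 * (m - 1) * d a * (\<Sum>b\<in>S - {a}. d b) + (m - 1) * (d a)\<^sup>2"
    by (simp add: sum.distrib sum_distrib_left card)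
  also have "\<dots> = (m - 1) * ((m - 1) * (\<Sum>b\<in>S. (d b)\<^sup>2) - m * (d a)\<^sup>2)"
    unfolding sum_d sum_sq by (simp add: power2_eq_square algebra_simps)
  finally show ?thesis .
qed

lemma deviation_bound:
  fixes d :: "'a \<Rightarrow> real"
  assumes "finite S" "a \<in> S" "sum d S = 0"
  defines "m \<equiv> real (card S)"
  assumes sq: "(\<Sum>b\<in>S. (d b)\<^sup>2) = n * (1 - 1 / m)" and "n \<ge> 0"
  shows "\<bar>d a\<bar> \<le> sqrt n * (1 - 1 / m)"
    and "\<lbrakk>\<bar>d a\<bar> = sqrt n * (1 - 1 / m); b \<in> S; b \<noteq> a\<rbrakk> \<Longrightarrow> d b = - d a / (m - 1)"
proof -
  have "card S \<ge> 1"
    using assms by (metis One_nat_def Suc_leI card_gt_0_iff empty_iff)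
  then have m1: "m \<ge> 1" by (simp add: m_def)
  have key: "(\<Sum>b\<in>S - {a}. ((m - 1) * d b + d a)\<^sup>2)
      = (m - 1) * m * ((sqrt n * (1 - 1 / m))\<^sup>2 - (d a)\<^sup>2)"
    using sum_squares_shifted_deviation[OF assms(1-3)] m1 \<open>n \<ge> 0\<close>
    unfolding m_def[symmetric] sq
    by (simp add: power_mult_distrib) (simp add: field_simps power2_eq_square)
  show "\<bar>d a\<bar> \<le> sqrt n * (1 - 1 / m)"
  proof (cases "m = 1")
    case True
    then obtain c where "S = {c}" by (auto simp: m_def card_1_singleton_iff)
    then show ?thesis using assms(2,3) True by simp
  next
    case False
    have "0 \<le> (m - 1) * m * ((sqrt n * (1 - 1 / m))\<^sup>2 - (d a)\<^sup>2)"
      unfolding key[symmetric] by (intro sum_nonneg) simp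
    moreover have "(m - 1) * m > 0" using False m1 by simp
    ultimately have "(d a)\<^sup>2 \<le> (sqrt n * (1 - 1 / m))\<^sup>2"
      by (simp add: zero_le_mult_iff)
    moreover have "0 \<le> sqrt n * (1 - 1 / m)" using m1 \<open>n \<ge> 0\<close> by simp
    ultimately show ?thesis by (simp add: abs_le_square_iff[symmetric])
  qed
  assume eq: "\<bar>d a\<bar> = sqrt n * (1 - 1 / m)" and b: "b \<in> S" "b \<noteq> a"
  have "(\<Sum>b\<in>S - {a}. ((m - 1) * d b + d a)\<^sup>2) = 0"
    unfolding key eq[symmetric] by simp
  then have "(m - 1) * d b + d a = 0"
    using b \<open>finite S\<close> by (subst (asm) sum_nonneg_eq_0_iff) auto
  moreover have "card {a, b} \<le> card S"
    using b assms(1,2) by (intro card_mono) auto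
  then have "m > 1" using b by (simp add: m_def)
  ultimately show "d b = - d a / (m - 1)" by (simp add: field_simps)
qed

lemma sum_card_preimage_set:
  assumes "finite (carrier G)" "finite (carrier H)" "F \<in> carrier G \<rightarrow> carrier H"
  shows "(\<Sum>\<beta>\<in>carrier H. card (preimage_set G F \<beta>)) = order G"
proof -
  have "carrier G = (\<Union>\<beta>\<in>carrier H. preimage_set G F \<beta>)"
    using assms by (auto simp: preimage_set_def)
  then have "order G = card (\<Union>\<beta>\<in>carrier H. preimage_set G F \<beta>)"
    by (simp add: order_def)
  also have "\<dots> = (\<Sum>\<beta>\<in>carrier H. card (preimage_set G F \<beta>))"
    using assms by (intro card_UN_disjoint) (auto simp: preimage_set_def)
  finally show ?thesis by simp
qed

lemma sum_card_preimage_set_squared: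
  assumes "group G" "finite (carrier G)" "finite (carrier H)" "F \<in> carrier G \<rightarrow> carrier H"
  shows "(\<Sum>\<beta>\<in>carrier H. (card (preimage_set G F \<beta>))\<^sup>2)
           = (\<Sum>a\<in>carrier G. card {x \<in> carrier G. F (x \<otimes>\<^bsub>G\<^esub> a) = F x})"
proof -
  interpret group G by fact
  let ?P = "{(x, y). x \<in> carrier G \<and> y \<in> carrier G \<and> F x = F y}"
  have "?P = (\<Union>\<beta>\<in>carrier H. preimage_set G F \<beta> \<times> preimage_set G F \<beta>)"
    using assms(4) by (auto simp: preimage_set_def)
  then have "card ?P = card (\<Union>\<beta>\<in>carrier H. preimage_set G F \<beta> \<times> preimage_set G F \<beta>)"
    by simp
  also have "\<dots> = (\<Sum>\<beta>\<in>carrier H. card (preimage_set G F \<beta> \<times> preimage_set G F \<beta>))"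
    using assms by (intro card_UN_disjoint) (auto simp: preimage_set_def)
  finally have by_fibre: "card ?P = (\<Sum>\<beta>\<in>carrier H. (card (preimage_set G F \<beta>))\<^sup>2)"
    by (simp add: card_cartesian_product power2_eq_square)
  let ?Q = "SIGMA a:carrier G. {x \<in> carrier G. F (x \<otimes>\<^bsub>G\<^esub> a) = F x}"
  have cancel: "inv\<^bsub>G\<^esub> x \<otimes>\<^bsub>G\<^esub> (x \<otimes>\<^bsub>G\<^esub> y) = y" "x \<otimes>\<^bsub>G\<^esub> (inv\<^bsub>G\<^esub> x \<otimes>\<^bsub>G\<^esub> y) = y"
    if "x \<in> carrier G" "y \<in> carrier G" for x y
    using that by (simp_all add: m_assoc[symmetric])
  have "bij_betw (\<lambda>(a, x). (x, x \<otimes>\<^bsub>G\<^esub> a)) ?Q ?P"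
    by (rule bij_betw_byWitness[where f' = "\<lambda>(x, y). (inv\<^bsub>G\<^esub> x \<otimes>\<^bsub>G\<^esub> y, x)"])
      (auto simp: cancel)
  then have "card ?Q = card ?P" by (rule bij_betw_same_card)
  then show ?thesis using by_fibre assms(2) by simp
qed

lemma perfect_nonlinear_card_translate:
  assumes "group G" "group H" "F \<in> carrier G \<rightarrow> carrier H" "perfect_nonlinear G H F"
    and "a \<in> carrier G" "a \<noteq> \<one>\<^bsub>G\<^esub>"
  shows "real (card {x \<in> carrier G. F (x \<otimes>\<^bsub>G\<^esub> a) = F x}) = real (order G) / real (order H)"
proof -
  interpret G: group G by fact
  interpret H: group H by fact
  have "F (x \<otimes>\<^bsub>G\<^esub> a) \<otimes>\<^bsub>H\<^esub> inv\<^bsub>H\<^esub> F x = \<one>\<^bsub>H\<^esub> \<longleftrightarrow> F (x \<otimes>\<^bsub>G\<^esub> a) = F x"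
    if "x \<in> carrier G" for x
  proof -
    have "F x \<in> carrier H" "F (x \<otimes>\<^bsub>G\<^esub> a) \<in> carrier H"
      using assms(3,5) that by auto
    then show ?thesis
      using H.inv_solve_right'[of "\<one>\<^bsub>H\<^esub>" "F (x \<otimes>\<^bsub>G\<^esub> a)" "F x"] by auto
  qed
  then have "{x \<in> carrier G. F (x \<otimes>\<^bsub>G\<^esub> a) = F x}
      = {x \<in> carrier G. F (x \<otimes>\<^bsub>G\<^esub> a) \<otimes>\<^bsub>H\<^esub> inv\<^bsub>H\<^esub> F x = \<one>\<^bsub>H\<^esub>}"
    by blast
  then show ?thesis
    using assms(4-6) by (simp add: perfect_nonlinear_def)
qed

lemma perfect_nonlinear_sum_card_squared:
  assumes "group G" "finite (carrier G)" "group H" "finite (carrier H)"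
    and "F \<in> carrier G \<rightarrow> carrier H" "perfect_nonlinear G H F"
  shows "(\<Sum>\<beta>\<in>carrier H. (real (card (preimage_set G F \<beta>)))\<^sup>2)
           = real (order G) + (real (order G) - 1) * (real (order G) / real (order H))"
proof -
  interpret G: group G by fact
  let ?c = "\<lambda>a. real (card {x \<in> carrier G. F (x \<otimes>\<^bsub>G\<^esub> a) = F x})"
  have "order G \<ge> 1"
    using assms(2) G.order_gt_0_iff_finite by (simp add: Suc_leI)
  then have card: "real (card (carrier G - {\<one>\<^bsub>G\<^esub>})) = real (order G) - 1"
    by (simp add: order_def of_nat_diff)
  have "(\<Sum>\<beta>\<in>carrier H. (real (card (preimage_set G F \<beta>)))\<^sup>2) = (\<Sum>a\<in>carrier G. ?c a)"
    using arg_cong[OF sum_card_preimage_set_squared[OF assms(1,2,4,5)], of real] by simp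
  also have "\<dots> = ?c \<one>\<^bsub>G\<^esub> + (\<Sum>a\<in>carrier G - {\<one>\<^bsub>G\<^esub>}. ?c a)"
    using assms(2) by (intro sum.remove) auto
  also have "{x \<in> carrier G. F (x \<otimes>\<^bsub>G\<^esub> \<one>\<^bsub>G\<^esub>) = F x} = carrier G"
    by auto
  also have "(\<Sum>a\<in>carrier G - {\<one>\<^bsub>G\<^esub>}. ?c a)
      = (\<Sum>a\<in>carrier G - {\<one>\<^bsub>G\<^esub>}. real (order G) / real (order H))"
    by (intro sum.cong) (auto intro!: perfect_nonlinear_card_translate[OF assms(1,3,5,6)])
  finally show ?thesis by (simp only: sum_constant card order_def)
qed

lemma perfect_nonlinear_order_dvd:
  assumes "group G" "finite (carrier G)" "group H" "finite (carrier H)"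
    and "F \<in> carrier G \<rightarrow> carrier H" "perfect_nonlinear G H F" "order G \<noteq> 1"
  shows "order H dvd order G"
proof -
  interpret G: group G by fact
  interpret H: group H by fact
  have "carrier G \<noteq> {\<one>\<^bsub>G\<^esub>}"
    using assms(7) by (auto simp: order_def)
  then obtain a where "a \<in> carrier G" "a \<noteq> \<one>\<^bsub>G\<^esub>"
    using G.one_closed by blast
  then have *: "real (card {x \<in> carrier G. F (x \<otimes>\<^bsub>G\<^esub> a) = F x})
      = real (order G) / real (order H)" (is "real ?c = _")
    using perfect_nonlinear_card_translate[OF assms(1,3,5,6)] by blast
  moreover have "order H > 0"
    using assms(4) H.order_gt_0_iff_finite by simp
  ultimately have "real (order G) = real (order H * ?c)"
    by (simp add: field_simps)
  then show ?thesis
    unfolding of_nat_eq_iff by (metis dvd_triv_left)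
qed

theorem theorem2p4:
  fixes G :: "('a, 'm) monoid_scheme" and H :: "('b, 'n) monoid_scheme" and F :: "'a \<Rightarrow> 'b"
  assumes "group G" and "finite (carrier G)"
    and "group H" and "finite (carrier H)"
    and "F \<in> carrier G \<rightarrow> carrier H"
    and "perfect_nonlinear G H F"
  shows
    "(\<forall>\<beta> \<in> carrier H.
        lower_bound G H \<le> real (card (preimage_set G F \<beta>)) \<and>
        real (card (preimage_set G F \<beta>)) \<le> upper_bound G H) \<and>
     (\<forall>\<alpha> \<in> carrier H. real (card (preimage_set G F \<alpha>)) = lower_bound G H \<longrightarrow>
        (\<forall>\<beta> \<in> carrier H. \<beta> \<noteq> \<alpha> \<longrightarrow>
           real (card (preimage_set G F \<beta>))
             = real (order G) / real (order H) + sqrt (real (order G)) / real (order H))) \<and>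
     (\<forall>\<alpha> \<in> carrier H. real (card (preimage_set G F \<alpha>)) = upper_bound G H \<longrightarrow>
        (\<forall>\<beta> \<in> carrier H. \<beta> \<noteq> \<alpha> \<longrightarrow>
           real (card (preimage_set G F \<beta>))
             = real (order G) / real (order H) - sqrt (real (order G)) / real (order H))) \<and>
     (order G \<noteq> 1 \<longrightarrow> order H \<noteq> 1 \<longrightarrow>
        (\<exists>\<alpha> \<in> carrier H. real (card (preimage_set G F \<alpha>)) = lower_bound G H \<or>
                        real (card (preimage_set G F \<alpha>)) = upper_bound G H) \<longrightarrow>
        (\<exists>s::nat. real s = sqrt (real (order G)) \<and> order H dvd s) \<and>
        (\<exists>r::nat. order G = r\<^sup>2))"
proof -
  interpret G: group G by fact
  interpret H: group H by fact
  define n m where "n = real (order G)" and "m = real (order H)"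
  define k where "k = (\<lambda>\<beta>. real (card (preimage_set G F \<beta>)))"
  define d where "d = (\<lambda>\<beta>. k \<beta> - n / m)"
  have m_pos: "m > 0"
    using assms(4) H.order_gt_0_iff_finite by (simp add: m_def)
  have n_nonneg: "n \<ge> 0" by (simp add: n_def)
  have card_H: "real (card (carrier H)) = m" by (simp add: m_def order_def)
  have sum_k: "sum k (carrier H) = n"
    using arg_cong[OF sum_card_preimage_set[OF assms(2,4,5)], of real]
    by (simp add: k_def n_def)
  have sum_k2: "(\<Sum>\<beta>\<in>carrier H. (k \<beta>)\<^sup>2) = n + (n - 1) * (n / m)"
    using perfect_nonlinear_sum_card_squared[OF assms] by (simp add: k_def n_def m_def)
  have sum_d: "sum d (carrier H) = 0"
    using m_pos by (simp add: d_def sum_subtractf sum_k card_H)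
  have "(\<Sum>\<beta>\<in>carrier H. (d \<beta>)\<^sup>2)
      = (\<Sum>\<beta>\<in>carrier H. (k \<beta>)\<^sup>2 - 2 * (n / m) * k \<beta> + (n / m)\<^sup>2)"
    by (intro sum.cong) (auto simp: d_def power2_eq_square algebra_simps)
  also have "\<dots> = n + (n - 1) * (n / m) - 2 * (n / m) * n + m * (n / m)\<^sup>2"
    by (simp only: sum.distrib sum_subtractf sum_distrib_left[symmetric] sum_k sum_k2 sum_constant
        card_H)
  also have "\<dots> = n * (1 - 1 / m)"
    using m_pos by (simp add: field_simps power2_eq_square)
  finally have sum_d2: "(\<Sum>\<beta>\<in>carrier H. (d \<beta>)\<^sup>2) = n * (1 - 1 / m)" .
  have lower: "lower_bound G H = n / m - sqrt n * (1 - 1 / m)"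
    and upper: "upper_bound G H = n / m + sqrt n * (1 - 1 / m)"
    by (simp_all add: lower_bound_def upper_bound_def n_def m_def algebra_simps)
  note bound = deviation_bound[OF assms(4) _ sum_d, unfolded card_H, OF _ sum_d2 n_nonneg]
  have m_gt_1: "m > 1" if "\<alpha> \<in> carrier H" "\<beta> \<in> carrier H" "\<beta> \<noteq> \<alpha>" for \<alpha> \<beta>
  proof -
    have "card {\<alpha>, \<beta>} \<le> card (carrier H)"
      using that assms(4) by (intro card_mono) auto
    then show ?thesis using that card_H by simp
  qed
  have nonneg: "sqrt n * (1 - 1 / m) \<ge> 0"
    using bound(1)[OF H.one_closed] by linarith
  have bounds: "lower_bound G H \<le> k \<beta> \<and> k \<beta> \<le> upper_bound G H" if "\<beta> \<in> carrier H" for \<beta>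
    using bound(1)[OF that] by (simp add: d_def lower upper abs_le_iff)
  have low: "k \<beta> = n / m + sqrt n / m"
    if "\<alpha> \<in> carrier H" "k \<alpha> = lower_bound G H" "\<beta> \<in> carrier H" "\<beta> \<noteq> \<alpha>" for \<alpha> \<beta>
  proof -
    have da: "d \<alpha> = - (sqrt n * (1 - 1 / m))"
      using that(2) by (simp add: d_def lower)
    then have "\<bar>d \<alpha>\<bar> = sqrt n * (1 - 1 / m)"
      using nonneg by (simp only: abs_minus_cancel abs_of_nonneg)
    then have "d \<beta> = - d \<alpha> / (m - 1)"
      by (rule bound(2)[OF that(1) _ that(3,4)])
    also have "\<dots> = sqrt n / m"
      using m_gt_1[OF that(1,3,4)] unfolding da by (simp add: divide_simps)
    finally show ?thesis by (simp add: d_def)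
  qed
  have up: "k \<beta> = n / m - sqrt n / m"
    if "\<alpha> \<in> carrier H" "k \<alpha> = upper_bound G H" "\<beta> \<in> carrier H" "\<beta> \<noteq> \<alpha>" for \<alpha> \<beta>
  proof -
    have da: "d \<alpha> = sqrt n * (1 - 1 / m)"
      using that(2) by (simp add: d_def upper)
    then have "\<bar>d \<alpha>\<bar> = sqrt n * (1 - 1 / m)"
      using nonneg by (simp only: abs_minus_cancel abs_of_nonneg)
    then have "d \<beta> = - d \<alpha> / (m - 1)"
      by (rule bound(2)[OF that(1) _ that(3,4)])
    also have "\<dots> = - (sqrt n / m)"
      using m_gt_1[OF that(1,3,4)] unfolding da by (simp add: divide_simps)
    finally show ?thesis by (simp add: d_def)
  qed
  have square: "(\<exists>s::nat. real s = sqrt n \<and> order H dvd s) \<and> (\<exists>r::nat. order G = r\<^sup>2)"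
    if G1: "order G \<noteq> 1" and H1: "order H \<noteq> 1" and \<alpha>: "\<alpha> \<in> carrier H"
      and eq: "k \<alpha> = lower_bound G H \<or> k \<alpha> = upper_bound G H" for \<alpha>
  proof -
    have "carrier H \<noteq> {\<alpha>}"
      using H1 by (auto simp: order_def)
    then obtain \<beta> where \<beta>: "\<beta> \<in> carrier H" "\<beta> \<noteq> \<alpha>"
      using \<alpha> by blast
    obtain q where q: "order G = order H * q"
      using perfect_nonlinear_order_dvd[OF assms G1] by (elim dvdE)
    then have nq: "n / m = real q"
      using m_pos by (simp add: n_def m_def)
    define ka kb where "ka = int (card (preimage_set G F \<alpha>))"
      and "kb = int (card (preimage_set G F \<beta>))"
    have k: "k \<alpha> = of_int ka" "k \<beta> = of_int kb"
      by (simp_all add: k_def ka_def kb_def)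
    have "\<bar>k \<beta> - k \<alpha>\<bar> = sqrt n \<and> \<bar>k \<beta> - n / m\<bar> = sqrt n / m"
      using eq
    proof
      assume a: "k \<alpha> = lower_bound G H"
      show ?thesis
        unfolding low[OF \<alpha> a \<beta>] unfolding a lower
        using n_nonneg m_pos by (simp add: algebra_simps)
    next
      assume a: "k \<alpha> = upper_bound G H"
      show ?thesis
        unfolding up[OF \<alpha> a \<beta>] unfolding a upper
        using n_nonneg m_pos by (simp add: algebra_simps)
    qed
    then have "of_int \<bar>kb - ka\<bar> = sqrt n" "of_int \<bar>kb - int q\<bar> = sqrt n / m"
      by (simp_all add: k nq)
    then have "real (nat \<bar>kb - ka\<bar>) = sqrt n" "real (nat \<bar>kb - int q\<bar>) = sqrt n / m"
      by simp_all
    then obtain s t :: nat where s: "real s = sqrt n" and t: "real t = sqrt n / m"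
      by blast
    have "real s = real (order H * t)"
      using s t m_pos by (simp add: m_def)
    then have "order H dvd s"
      unfolding of_nat_eq_iff by (metis dvd_triv_left)
    moreover have "real (order G) = real (s\<^sup>2)"
      using s n_nonneg by (simp add: n_def)
    then have "order G = s\<^sup>2"
      unfolding of_nat_eq_iff .
    ultimately show ?thesis using s by blast
  qed
  show ?thesis
    using bounds low up square unfolding k_def n_def m_def by blast
qed

end
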